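(* Let $n\ge1$ and let $S(n,i)$ be the number of 0-1-2 increasing trees on $[n]$ with $i$ leaves. Then $$\sum_{i=1}^{\lfloor (n+2)/2\rfloor}2^{i-1}S(n,i)x^i=\sum_{T}G_T\;\lambda(T)!\;x^{\,n+1-\ell(\lambda(T))},$$ where the sum on the right is over all standard Young tableaux $T\in\mathrm{SYT}(n)$ with at most two columns.
   Context: **Trees.** An increasing tree on $[n]$ is a rooted (unordered) tree with vertex set $\{0,1,2,\ldots,n\}$ in which the labels of the vertices are increasing along any path from the root $0$. The degree of a vertex is the number of its children. A 0-1-2 increasing tree is an increasing tree in which every vertex has degree at most two. A leaf is a vertex with no children. **Standard Young tableaux.** $\mathrm{SYT}(n)$ is the set of standard Young tableaux of size $n$, drawn with rows numbered from bottom to top: for a partition $\lambda=(\lambda_1\ge\lambda_2\ge\cdots)$ of $n$, row $r$ has $\lambda_r$ left-justified boxes, the boxes are filled with $1,\ldots,n$ each used once, rows increase from left to right and columns increase from bottom to top. $\lambda(T)=(\lambda_1,\ldots,\lambda_\ell)$ (positive parts) is the shape of $T$, $\ell(\lambda(T))=\ell$, and $\lambda(T)!=\lambda_1!\lambda_2!\cdots\lambda_\ell!$. **$g$-index.** To the left of $T\in\mathrm{SYT}(n)$ one adds a special column (column 0, not counted among the columns of $T$) of $n$ boxes in rows $1,\ldots,n$, the box in row $r$ containing the label $r$. If $v\in\{1,\ldots,n\}$ is in column $i\ge1$ and row $j\ge 1$ of $T$, $g_T(v)$ is the number of boxes in column $i-1$ and in rows $j'\ge j$ whose entry is less than or equal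 to $v$ (for $i=1$ the boxes counted are those of column 0). The $g$-index of $T$ is $G_T=g_T(1)g_T(2)\cdots g_T(n)$. *)

theory Defs
  imports "HOL-Computational_Algebra.Polynomial"
begin

text \<open>A rooted unordered tree on the vertex set \<open>V\<close> is given by its set of arcs
  \<open>(parent, child)\<close>, so that distinct trees are distinct sets of arcs.\<close>

definition rooted_tree :: "'a set \<Rightarrow> 'a \<Rightarrow> 'a rel \<Rightarrow> bool" where
  "rooted_tree V r E \<longleftrightarrow>
     r \<in> V \<and> E \<subseteq> V \<times> V \<and>
     (\<forall>u. (u, r) \<notin> E) \<and>
     (\<forall>v\<in>V - {r}. \<exists>!u. (u, v) \<in> E) \<and>
     (\<forall>v\<in>V. (r, v) \<in> E\<^sup>*)"

definition increasing_tree :: "nat \<Rightarrow> nat rel \<Rightarrow> bool" where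
  "increasing_tree n E \<longleftrightarrow>
     rooted_tree {0..n} 0 E \<and>
     (\<forall>u v. (0, u) \<in> E\<^sup>* \<and> (u, v) \<in> E \<longrightarrow> u < v)"

definition degree_in :: "'a rel \<Rightarrow> 'a \<Rightarrow> nat" where
  "degree_in E u = card {v. (u, v) \<in> E}"

definition trees_012 :: "nat \<Rightarrow> nat rel set" where
  "trees_012 n = {E. increasing_tree n E \<and> (\<forall>u\<in>{0..n}. degree_in E u \<le> 2)}"

definition num_leaves :: "nat \<Rightarrow> nat rel \<Rightarrow> nat" where
  "num_leaves n E = card {u\<in>{0..n}. degree_in E u = 0}"

definition S :: "nat \<Rightarrow> nat \<Rightarrow> nat" where
  "S n i = card {E\<in>trees_012 n. num_leaves n E = i}"

text \<open>A tableau is the list of its rows, from bottom to top; each row is read from left to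
  right. A box is a pair (row, column), both counted from 1.\<close>

type_synonym tableau = "nat list list"

definition shape :: "tableau \<Rightarrow> nat list" where
  "shape T = map length T"

definition tsize :: "tableau \<Rightarrow> nat" where
  "tsize T = sum_list (shape T)"

definition boxes :: "tableau \<Rightarrow> (nat \<times> nat) set" where
  "boxes T = {(r, c). 1 \<le> r \<and> r \<le> length T \<and> 1 \<le> c \<and> c \<le> length (T ! (r - 1))}"

definition entry :: "tableau \<Rightarrow> nat \<times> nat \<Rightarrow> nat" where
  "entry T = (\<lambda>(r, c). T ! (r - 1) ! (c - 1))"

definition SYT :: "nat \<Rightarrow> tableau set" where
  "SYT n = {T.
     sorted_wrt (\<ge>) (shape T) \<and> (\<forall>k\<in>set (shape T). 0 < k) \<and> tsize T = n \<and>
     bij_betw (entry T) (boxes T) {1..n} \<and>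
     (\<forall>r c. (r, c) \<in> boxes T \<and> (r, Suc c) \<in> boxes T \<longrightarrow> entry T (r, c) < entry T (r, Suc c)) \<and>
     (\<forall>r c. (r, c) \<in> boxes T \<and> (Suc r, c) \<in> boxes T \<longrightarrow> entry T (r, c) < entry T (Suc r, c))}"

definition shape_fact :: "tableau \<Rightarrow> nat" where
  "shape_fact T = prod_list (map fact (shape T))"

text \<open>The extended tableau has the additional column 0 with boxes in the rows \<open>1, \<dots>, n\<close>,
  where \<open>n\<close> is the size of the tableau; the box in row \<open>r\<close> of that column contains \<open>r\<close>.\<close>

definition ext_boxes :: "tableau \<Rightarrow> (nat \<times> nat) set" where
  "ext_boxes T = {1..tsize T} \<times> {0} \<union> boxes T"

definition ext_entry :: "tableau \<Rightarrow> nat \<times> nat \<Rightarrow> nat" where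
  "ext_entry T = (\<lambda>(r, c). if c = 0 then r else entry T (r, c))"

definition position :: "tableau \<Rightarrow> nat \<Rightarrow> nat \<times> nat" where
  "position T v = (THE b. b \<in> boxes T \<and> entry T b = v)"

definition g :: "tableau \<Rightarrow> nat \<Rightarrow> nat" where
  "g T v = (case position T v of (j, i) \<Rightarrow>
     card {j'. j \<le> j' \<and> (j', i - 1) \<in> ext_boxes T \<and> ext_entry T (j', i - 1) \<le> v})"

definition g_index :: "tableau \<Rightarrow> nat" where
  "g_index T = (\<Prod>v=1..tsize T. g T v)"

lemma finite_trees_012: "finite (trees_012 n)"
proof (rule finite_subset)
  show "trees_012 n \<subseteq> Pow ({0..n} \<times> {0..n})"
    by (auto simp: trees_012_def increasing_tree_def rooted_tree_def)
qed simp

lemma finite_SYT: "finite (SYT n)"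
proof (rule finite_subset)
  let ?R = "{xs. set xs \<subseteq> {1..n} \<and> length xs \<le> n}"
  show "finite {T. set T \<subseteq> ?R \<and> length T \<le> n}"
    by (intro finite_lists_length_le) simp
  show "SYT n \<subseteq> {T. set T \<subseteq> ?R \<and> length T \<le> n}"
  proof
    fix T assume T: "T \<in> SYT n"
    have size: "sum_list (map length T) = n" and pos: "\<forall>xs\<in>set T. 0 < length xs"
      and img: "entry T ` boxes T = {1..n}"
      using T by (auto simp: SYT_def tsize_def shape_def bij_betw_def)
    have "sum_list (map (\<lambda>_. 1) T) \<le> sum_list (map length T)"
      using pos by (intro sum_list_mono) (auto simp: Suc_le_eq)
    then have len: "length T \<le> n"
      by (simp add: size sum_list_triv)
    have "xs \<in> ?R" if xs: "xs \<in> set T" for xs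
    proof -
      have "length xs \<le> n"
        using member_le_sum_list[of "length xs" "map length T"] xs size by auto
      moreover have "x \<in> {1..n}" if x: "x \<in> set xs" for x
      proof -
        obtain r where r: "r < length T" "xs = T ! r"
          using xs by (auto simp: in_set_conv_nth)
        obtain c where c: "c < length xs" "x = xs ! c"
          using x by (auto simp: in_set_conv_nth)
        have "(Suc r, Suc c) \<in> boxes T" "entry T (Suc r, Suc c) = x"
          using r c by (auto simp: boxes_def entry_def)
        then show ?thesis using img by (metis imageI)
      qed
      ultimately show ?thesis by blast
    qed
    then show "T \<in> {T. set T \<subseteq> ?R \<and> length T \<le> n}" using len by blast
  qed
qed

end

theory Submission
  imports Defs
begin

text \<open>Both sides satisfy the same recurrence. Inserting the vertex \<open>n + 1\<close> into a 0-1-2 increasing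
  tree on \<open>[n]\<close> with \<open>i\<close> leaves keeps the number of leaves when its parent is one of the \<open>i\<close>
  leaves, and raises it by one when its parent is one of the \<open>n + 2 - 2i\<close> vertices of degree one.
  Inserting the entry \<open>n + 1\<close> into a two-column tableau with columns of heights \<open>a \<ge> b\<close> multiplies
  the \<open>g\<close>-index by \<open>b + 1\<close> in the first column and by \<open>a - b = n - 2b\<close> in the second, so with
  \<open>i = b + 1\<close> the weights agree; the forbidden insertion for \<open>a = b\<close> has weight zero.\<close>

section \<open>Increasing trees\<close>

text \<open>Parents have smaller labels, so strong induction along parents recovers reachability
  from the root. Conversely, reachability makes the increase condition hold on every arc. This local
  form drives all later tree arguments.\<close>

lemma increasing_tree_iff:
  "increasing_tree n E \<longleftrightarrow>
     E \<subseteq> {0..n} \<times> {0..n} \<and> (\<forall>u v. (u, v) \<in> E \<longrightarrow> u < v) \<and> (\<forall>v\<in>{1..n}. \<exists>!u. (u, v) \<in> E)"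
  (is "?L \<longleftrightarrow> ?R")
proof
  assume L: ?L
  then have sub: "E \<subseteq> {0..n} \<times> {0..n}" by (auto simp: increasing_tree_def rooted_tree_def)
  moreover have "u < v" if "(u, v) \<in> E" for u v
    using L sub that unfolding increasing_tree_def rooted_tree_def by blast
  moreover have "\<exists>!u. (u, v) \<in> E" if "v \<in> {1..n}" for v
    using L that by (auto simp: increasing_tree_def rooted_tree_def)
  ultimately show ?R by blast
next
  assume R: ?R
  have "v \<le> n \<Longrightarrow> (0, v) \<in> E\<^sup>*" for v
  proof (induction v rule: less_induct)
    case (less v)
    show ?case
    proof (cases "v = 0")
      case False
      then obtain u where "(u, v) \<in> E" using R less.prems by force
      moreover from this have "u < v" using R by blast
      ultimately show ?thesis
        using less.IH[of u] less.prems by (meson less_imp_le order.trans rtrancl.rtrancl_into_rtrancl)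
    qed simp
  qed
  moreover have "\<exists>!u. (u, v) \<in> E" if "v \<in> {0..n} - {0}" for v
    using R that by auto
  moreover have "(u, 0) \<notin> E" for u using R by blast
  ultimately show ?L
    using R by (auto simp: increasing_tree_def rooted_tree_def)
qed

section \<open>Adding and removing the vertex with the largest label\<close>

lemma increasing_tree_insert:
  assumes "increasing_tree n F" "u \<le> n"
  shows "increasing_tree (Suc n) (insert (u, Suc n) F)"
proof -
  have F: "F \<subseteq> {0..n} \<times> {0..n}" "\<forall>v\<in>{1..n}. \<exists>!u. (u, v) \<in> F" "\<forall>u v. (u, v) \<in> F \<longrightarrow> u < v"
    using assms(1) by (auto simp: increasing_tree_iff)
  have "\<exists>!w. (w, v) \<in> insert (u, Suc n) F" if v: "v \<in> {1..Suc n}" for v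
  proof (cases "v = Suc n")
    case True
    have "(w, Suc n) \<notin> F" for w using F(1) by auto
    then show ?thesis using True by auto
  next
    case False
    then have "v \<in> {1..n}" using v by auto
    then show ?thesis using F(2) False by simp
  qed
  moreover have "insert (u, Suc n) F \<subseteq> {0..Suc n} \<times> {0..Suc n}"
    using F(1) assms(2) by auto
  ultimately show ?thesis
    using F(3) assms(2) unfolding increasing_tree_iff by auto
qed

text \<open>The largest label \<open>Suc n\<close> cannot be a parent, so deleting the one arc that
  enters it leaves an increasing tree on the smaller vertex set.\<close>

lemma increasing_tree_SucE:
  assumes "increasing_tree (Suc n) E"
  obtains u F where "u \<le> n" "increasing_tree n F" "E = insert (u, Suc n) F"
proof -
  have E: "E \<subseteq> {0..Suc n} \<times> {0..Suc n}" "\<forall>v\<in>{1..Suc n}. \<exists>!u. (u, v) \<in> E"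
    "\<forall>u v. (u, v) \<in> E \<longrightarrow> u < v"
    using assms by (auto simp: increasing_tree_iff)
  obtain u where u: "(u, Suc n) \<in> E" and uniq: "\<And>w. (w, Suc n) \<in> E \<Longrightarrow> w = u"
    using E(2) by (metis atLeastAtMost_iff le_add1 order_refl plus_1_eq_Suc)
  let ?F = "E - {(u, Suc n)}"
  have "?F \<subseteq> {0..n} \<times> {0..n}"
  proof
    fix p assume p: "p \<in> ?F"
    obtain x y where xy: "p = (x, y)" by force
    have "y \<noteq> Suc n" using p xy uniq by auto
    moreover have "x < y" "y \<le> Suc n" using p xy E(1,3) by auto
    ultimately show "p \<in> {0..n} \<times> {0..n}" using xy by simp
  qed
  moreover have "\<exists>!w. (w, v) \<in> ?F" if "v \<in> {1..n}" for v
  proof -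
    have "(w, v) \<in> ?F \<longleftrightarrow> (w, v) \<in> E" for w using that by auto
    then show ?thesis using E(2) that by auto
  qed
  ultimately have "increasing_tree n ?F"
    using E(3) by (simp add: increasing_tree_iff)
  moreover have "u \<le> n" using E(3) u by fastforce
  ultimately show thesis using u that[of u ?F] by blast
qed

lemma degree_in_insert:
  assumes "increasing_tree n F"
  shows "degree_in (insert (u, Suc n) F) w = (if w = u then Suc (degree_in F w) else degree_in F w)"
proof -
  have F: "F \<subseteq> {0..n} \<times> {0..n}" using assms by (simp add: increasing_tree_iff)
  have "{v. (w, v) \<in> F} \<subseteq> {0..n}" using F by auto
  then have fin: "finite {v. (w, v) \<in> F}" and nin: "Suc n \<notin> {v. (w, v) \<in> F}"
    by (auto intro: finite_subset)
  have "{v. (w, v) \<in> insert (u, Suc n) F} =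
      (if w = u then insert (Suc n) {v. (w, v) \<in> F} else {v. (w, v) \<in> F})"
    by auto
  then show ?thesis unfolding degree_in_def using fin nin by auto
qed

lemma degree_in_outside:
  assumes "increasing_tree n F" "n < w"
  shows "degree_in F w = 0"
proof -
  have "{v. (w, v) \<in> F} = {}" using assms by (auto simp: increasing_tree_iff)
  then show ?thesis by (simp add: degree_in_def)
qed

text \<open>Attaching \<open>Suc n\<close> raises only the degree of its parent \<open>u\<close>,
  and the new vertex itself has no children. Hence the degree bound survives exactly when
  \<open>u\<close> had at most one child.\<close>

lemma trees_012_Suc:
  "trees_012 (Suc n) =
     (\<lambda>(F, u). insert (u, Suc n) F) ` (SIGMA F:trees_012 n. {u\<in>{0..n}. degree_in F u \<le> 1})"
proof (intro equalityI subsetI)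
  fix E assume E: "E \<in> trees_012 (Suc n)"
  then obtain u F where uF: "u \<le> n" "increasing_tree n F" "E = insert (u, Suc n) F"
    by (auto simp: trees_012_def elim: increasing_tree_SucE)
  have deg: "(if w = u then Suc (degree_in F w) else degree_in F w) \<le> 2" if "w \<le> n" for w
    using E that uF by (auto simp: trees_012_def simp flip: degree_in_insert[OF uF(2)])
  have "degree_in F w \<le> 2" if "w \<le> n" for w
    using deg[OF that] by (auto split: if_splits)
  then have "F \<in> trees_012 n" using uF by (simp add: trees_012_def)
  moreover have "degree_in F u \<le> 1" using deg[OF uF(1)] by simp
  ultimately show "E \<in> (\<lambda>(F, u). insert (u, Suc n) F) `
      (SIGMA F:trees_012 n. {u\<in>{0..n}. degree_in F u \<le> 1})"
    using uF by force
next
  fix E assume "E \<in> (\<lambda>(F, u). insert (u, Suc n) F) `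
      (SIGMA F:trees_012 n. {u\<in>{0..n}. degree_in F u \<le> 1})"
  then obtain u F where uF: "F \<in> trees_012 n" "u \<le> n" "degree_in F u \<le> 1"
    "E = insert (u, Suc n) F"
    by auto
  then have F: "increasing_tree n F" by (simp add: trees_012_def)
  have "degree_in E w \<le> 2" if "w \<le> Suc n" for w
    using uF that degree_in_outside[OF F, of w]
    by (cases "w = Suc n") (auto simp: degree_in_insert[OF F] trees_012_def)
  then show "E \<in> trees_012 (Suc n)"
    using increasing_tree_insert[OF F uF(2)] uF(4) by (simp add: trees_012_def)
qed

text \<open>No arc of the smaller tree ends in \<open>Suc n\<close>, so the parent \<open>u\<close>,
  and then \<open>F\<close>, can be read off from the enlarged tree.\<close>

lemma inj_on_insert_vertex:
  "inj_on (\<lambda>(F, u). insert (u, Suc n) F) (SIGMA F:trees_012 n. {u\<in>{0..n}. degree_in F u \<le> 1})"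
proof (rule inj_onI, clarsimp)
  fix F u F' u'
  assume a: "F \<in> trees_012 n" "F' \<in> trees_012 n" and
    eq: "insert (u, Suc n) F = insert (u', Suc n) F'"
  have "(w, Suc n) \<notin> F" "(w, Suc n) \<notin> F'" for w
    using a by (auto simp: trees_012_def increasing_tree_iff)
  then show "F = F' \<and> u = u'" using eq by (metis Pair_inject insert_ident insert_iff)
qed

lemma num_leaves_insert:
  assumes "increasing_tree n F" "u \<le> n"
  shows "num_leaves (Suc n) (insert (u, Suc n) F) =
    (if degree_in F u = 0 then num_leaves n F else Suc (num_leaves n F))"
proof -
  let ?A = "{w\<in>{0..n}. degree_in F w = 0}"
  \<comment> \<open>The new vertex is a leaf and its parent no longer is one; removing
    \<open>u\<close> changes nothing if it was not a leaf before.\<close>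
  have "{w\<in>{0..Suc n}. degree_in (insert (u, Suc n) F) w = 0} = insert (Suc n) (?A - {u})"
    using degree_in_outside[OF assms(1), of "Suc n"] assms(2)
    by (auto simp: degree_in_insert[OF assms(1)] le_Suc_eq split: if_splits)
  then have "num_leaves (Suc n) (insert (u, Suc n) F) = Suc (card (?A - {u}))"
    by (simp add: num_leaves_def)
  also have "\<dots> = (if degree_in F u = 0 then card ?A else Suc (card ?A))"
  proof (cases "degree_in F u = 0")
    case True
    then have "u \<in> ?A" using assms(2) by simp
    then have "Suc (card (?A - {u})) = card ?A" by (intro card_Suc_Diff1) simp_all
    then show ?thesis using True by simp
  qed simp
  finally show ?thesis by (simp add: num_leaves_def)
qed

text \<open>Each vertex other than the root is the child in exactly one arc, so \<open>snd\<close>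
  maps \<open>E\<close> bijectively onto \<open>{1..n}\<close>.\<close>

lemma card_increasing_tree:
  assumes "increasing_tree n E"
  shows "card E = n"
proof -
  have E: "E \<subseteq> {0..n} \<times> {0..n}" "\<And>v. v \<in> {1..n} \<Longrightarrow> \<exists>!u. (u, v) \<in> E"
    "\<And>u v. (u, v) \<in> E \<Longrightarrow> u < v"
    using assms by (auto simp: increasing_tree_iff)
  have range: "v \<in> {1..n}" if "(u, v) \<in> E" for u v
    using E(1) E(3)[OF that] that by auto
  have "inj_on snd E"
  proof (rule inj_onI)
    fix p q assume pq: "p \<in> E" "q \<in> E" "snd p = snd q"
    obtain u v w where uvw: "p = (u, w)" "q = (v, w)" using pq(3) by (metis prod.collapse)
    then have "u = v" using E(2)[OF range, of u w] pq by blast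
    then show "p = q" using uvw by simp
  qed
  moreover have "snd ` E = {1..n}"
  proof (intro equalityI subsetI)
    fix v assume "v \<in> {1..n}"
    then obtain u where "(u, v) \<in> E" using E(2) by blast
    then show "v \<in> snd ` E" by force
  qed (use range in auto)
  ultimately show ?thesis using card_image[of snd E] by simp
qed

text \<open>The degrees of the \<open>n + 1\<close> vertices sum to the number \<open>n\<close> of
  arcs, while \<open>n + 1\<close> vertices of degree two would give \<open>2 * (n + 1)\<close>. The
  deficit \<open>n + 2\<close> comes from the leaves, with two each, and the vertices of degree one,
  with one each.\<close>

lemma card_degree_one:
  assumes "E \<in> trees_012 n"
  shows "card {u\<in>{0..n}. degree_in E u = 1} + 2 * num_leaves n E = n + 2"
proof -
  have inc: "increasing_tree n E" and deg: "\<And>u. u \<le> n \<Longrightarrow> degree_in E u \<le> 2"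
    using assms by (auto simp: trees_012_def)
  have sub: "E \<subseteq> {0..n} \<times> {0..n}" using inc by (simp add: increasing_tree_iff)
  have "E = (SIGMA u:{0..n}. {v. (u, v) \<in> E})" using sub by auto
  then have "n = card (SIGMA u:{0..n}. {v. (u, v) \<in> E})"
    using card_increasing_tree[OF inc] by simp
  also have "\<dots> = (\<Sum>u=0..n. degree_in E u)"
  proof -
    have "finite {v. (u, v) \<in> E}" for u
      by (rule finite_subset[of _ "{0..n}"]) (use sub in auto)
    then show ?thesis by (simp add: degree_in_def)
  qed
  finally have sum: "(\<Sum>u=0..n. degree_in E u) = n" by simp
  have "(\<Sum>u=0..n. degree_in E u + 2 * of_bool (degree_in E u = 0) + of_bool (degree_in E u = 1))
      = (\<Sum>u=0..n. 2)"
  proof (rule sum.cong)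
    fix u assume "u \<in> {0..n}"
    then have "degree_in E u = 0 \<or> degree_in E u = 1 \<or> degree_in E u = 2"
      using deg[of u] by auto
    then show "degree_in E u + 2 * of_bool (degree_in E u = 0) + of_bool (degree_in E u = 1) = 2"
      by auto
  qed simp
  moreover have "(\<Sum>u=0..n. of_bool (degree_in E u = c)) = card {u\<in>{0..n}. degree_in E u = c}" for c
    by (simp add: sum_of_bool_eq Int_def)
  ultimately show ?thesis
    by (simp add: sum.distrib sum num_leaves_def flip: sum_distrib_left)
qed

section \<open>The recurrence for the number of trees with given leaves\<close>

lemma S_0_right: "S n 0 = 0"
proof -
  have "num_leaves n E \<noteq> 0" if "E \<in> trees_012 n" for E
  proof -
    \<comment> \<open>Without leaves, \<open>card_degree_one\<close> would demand
      \<open>n + 2\<close> vertices of degree one among only \<open>n + 1\<close>.\<close>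
    have "card {u\<in>{0..n}. degree_in E u = 1} \<le> card {0..n}" by (rule card_mono) auto
    then show ?thesis using card_degree_one[OF that] by simp
  qed
  then have "{E \<in> trees_012 n. num_leaves n E = 0} = {}" by auto
  then show ?thesis unfolding S_def by (simp only: card.empty)
qed

lemma S_0_left: "S 0 (Suc b) = (if b = 0 then 1 else 0)"
proof -
  have "trees_012 0 = {{}}"
    by (auto simp: trees_012_def increasing_tree_iff degree_in_def)
  moreover have "num_leaves 0 {} = 1" by (simp add: num_leaves_def degree_in_def)
  ultimately have "{E \<in> trees_012 0. num_leaves 0 E = Suc b} = (if b = 0 then {{}} else {})"
    by auto
  then show ?thesis by (simp add: S_def)
qed

text \<open>The truncated difference is safe: if some tree has \<open>b\<close> leaves, then
  \<open>card_degree_one\<close> makes \<open>n + 2 - 2 * b\<close> its number of vertices of degree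
  one, and otherwise \<open>S n b\<close> is zero.\<close>

lemma S_Suc: "S (Suc n) (Suc b) = Suc b * S n (Suc b) + (n + 2 - 2 * b) * S n b"
proof -
  let ?U = "\<lambda>F. {u\<in>{0..n}. degree_in F u \<le> 1}"
  let ?V = "\<lambda>F. {u\<in>?U F. num_leaves (Suc n) (insert (u, Suc n) F) = Suc b}"
  let ?f = "\<lambda>(F, u). insert (u, Suc n) F"
  have "{E\<in>trees_012 (Suc n). num_leaves (Suc n) E = Suc b} = ?f ` (SIGMA F:trees_012 n. ?V F)"
    unfolding trees_012_Suc by auto
  moreover have "inj_on ?f (SIGMA F:trees_012 n. ?V F)"
    by (rule inj_on_subset[OF inj_on_insert_vertex]) auto
  ultimately have "S (Suc n) (Suc b) = card (SIGMA F:trees_012 n. ?V F)"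
    by (simp add: S_def card_image)
  also have "\<dots> = (\<Sum>F\<in>trees_012 n. card (?V F))"
    by (simp add: finite_trees_012)
  also have "\<dots> = (\<Sum>F\<in>trees_012 n. Suc b * of_bool (num_leaves n F = Suc b) +
      (n + 2 - 2 * b) * of_bool (num_leaves n F = b))"
  proof (rule sum.cong)
    fix F assume F: "F \<in> trees_012 n"
    then have inc: "increasing_tree n F" by (simp add: trees_012_def)
    \<comment> \<open>A parent that is a leaf keeps the leaf count and one of degree one raises it,
      so the leaf count of \<open>F\<close> decides which kind of parent leads to
      \<open>Suc b\<close> leaves.\<close>
    have "?V F = (if num_leaves n F = Suc b then {u\<in>{0..n}. degree_in F u = 0}
        else if num_leaves n F = b then {u\<in>{0..n}. degree_in F u = 1} else {})"
      by (auto simp: num_leaves_insert[OF inc] split: if_splits)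
    moreover have "card {u\<in>{0..n}. degree_in F u = 1} = n + 2 - 2 * num_leaves n F"
      using card_degree_one[OF F] by simp
    moreover have "card {u\<in>{0..n}. degree_in F u = 0} = num_leaves n F"
      by (simp add: num_leaves_def)
    ultimately show "card (?V F) = Suc b * of_bool (num_leaves n F = Suc b) +
      (n + 2 - 2 * b) * of_bool (num_leaves n F = b)"
      by simp
  qed simp
  also have "\<dots> = Suc b * S n (Suc b) + (n + 2 - 2 * b) * S n b"
    by (simp add: sum.distrib S_def sum_of_bool_eq finite_trees_012 Int_def flip: sum_distrib_left
        del: mult_Suc)
  finally show ?thesis .
qed

section \<open>Two-column tableaux\<close>

text \<open>These are the standard tableaux with at most two columns, given by their columns read
  from bottom to top; \<open>b\<close> is the height of the second column. Positions count from 0,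
  so \<open>xs ! k\<close> and \<open>ys ! k\<close> stand in row \<open>k + 1\<close>.\<close>

definition column_pairs :: "nat \<Rightarrow> nat \<Rightarrow> (nat list \<times> nat list) set" where
  "column_pairs n b = {(xs, ys).
     sorted_wrt (<) xs \<and> sorted_wrt (<) ys \<and> length ys = b \<and> length ys \<le> length xs \<and>
     (\<forall>k<length ys. xs ! k < ys ! k) \<and> set xs \<union> set ys = {1..n} \<and> set xs \<inter> set ys = {}}"

text \<open>This is the \<open>g\<close>-index in terms of columns. For the entry
  \<open>xs ! k\<close> in row \<open>k + 1\<close>, the boxes counted in column 0 are those in rows
  \<open>k + 1\<close> to \<open>xs ! k\<close>, hence \<open>xs ! k - k\<close> of them.\<close>

definition column_weight :: "nat list \<times> nat list \<Rightarrow> nat" where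
  "column_weight = (\<lambda>(xs, ys). (\<Prod>k<length xs. xs ! k - k) *
     (\<Prod>k<length ys. card {j. k \<le> j \<and> j < length xs \<and> xs ! j \<le> ys ! k}))"

definition of_columns :: "nat list \<times> nat list \<Rightarrow> tableau" where
  "of_columns = (\<lambda>(xs, ys).
     map (\<lambda>k. if k < length ys then [xs ! k, ys ! k] else [xs ! k]) [0..<length xs])"

lemma finite_column_pairs: "finite (column_pairs n b)"
proof (rule finite_subset)
  let ?L = "{xs. set xs \<subseteq> {1..n} \<and> length xs \<le> n}"
  show "column_pairs n b \<subseteq> ?L \<times> ?L"
  proof
    fix p assume p: "p \<in> column_pairs n b"
    have "length xs \<le> n" if "sorted_wrt (<) xs" "set xs \<subseteq> {1..n}" for xs
      using that card_mono[of "{1..n}" "set xs"] distinct_card[of xs]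
      by (simp add: strict_sorted_iff)
    then show "p \<in> ?L \<times> ?L" using p by (auto simp: column_pairs_def)
  qed
  show "finite (?L \<times> ?L)" by (intro finite_cartesian_product finite_lists_length_le) auto
qed

lemma length_column_pairs:
  assumes "(xs, ys) \<in> column_pairs n b"
  shows "length xs + b = n"
proof -
  have "card (set xs \<union> set ys) = card (set xs) + card (set ys)"
    using assms by (intro card_Un_disjoint) (auto simp: column_pairs_def)
  then show ?thesis
    using assms by (auto simp: column_pairs_def strict_sorted_iff distinct_card)
qed

section \<open>Removing the largest entry, and the recurrence for the weights\<close>

lemma strict_sorted_snoc_Max:
  fixes m :: "'a::linorder"
  assumes "sorted_wrt (<) xs" "m \<in> set xs" "\<And>x. x \<in> set xs \<Longrightarrow> x \<le> m"
  obtains zs where "xs = zs @ [m]"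
proof -
  obtain zs z where xs: "xs = zs @ [z]" using assms(2) by (cases xs rule: rev_exhaust) auto
  then have "m = z" using assms by (fastforce simp: sorted_wrt_append)
  then show thesis using xs that by blast
qed

text \<open>The largest entry sits on top of its column. Above the second column it needs a left
  neighbour, whence the strict inequality of lengths; \<open>0 < b\<close> keeps
  \<open>b - 1\<close> from being truncated.\<close>

lemma column_pairs_Suc:
  "column_pairs (Suc n) b =
     (\<lambda>(xs, ys). (xs @ [Suc n], ys)) ` column_pairs n b \<union>
     (\<lambda>(xs, ys). (xs, ys @ [Suc n])) `
       {(xs, ys). 0 < b \<and> (xs, ys) \<in> column_pairs n (b - 1) \<and> length ys < length xs}"
  (is "?L = ?f ` ?A \<union> ?h ` ?B")
proof (intro equalityI subsetI)
  fix p assume "p \<in> ?L"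
  then obtain xs ys where p: "p = (xs, ys)" and sorted: "sorted_wrt (<) xs" "sorted_wrt (<) ys"
    and len: "length ys = b" "length ys \<le> length xs"
    and less: "\<forall>k<length ys. xs ! k < ys ! k"
    and un: "set xs \<union> set ys = {1..Suc n}" and disj: "set xs \<inter> set ys = {}"
    by (auto simp: column_pairs_def)
  have bound: "x \<le> Suc n" if "x \<in> set xs \<union> set ys" for x using that un by auto
  have "Suc n \<in> set xs \<union> set ys" using un by simp
  then show "p \<in> ?f ` ?A \<union> ?h ` ?B"
  proof
    assume "Suc n \<in> set xs"
    then obtain zs where zs: "xs = zs @ [Suc n]"
      using strict_sorted_snoc_Max[OF sorted(1)] bound by blast
    \<comment> \<open>With equal heights, the box to the right of \<open>Suc n\<close> would have to
      hold a larger entry.\<close>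
    have "length ys \<noteq> length xs"
    proof
      assume eq: "length ys = length xs"
      then have "xs ! length zs < ys ! length zs" using less[rule_format, of "length zs"] zs by simp
      moreover have "ys ! length zs \<in> set ys" using eq zs by simp
      ultimately show False using bound[of "ys ! length zs"] zs by simp
    qed
    then have "length ys \<le> length zs" using len zs by simp
    moreover have "\<forall>k<length ys. zs ! k < ys ! k"
      using less calculation by (auto simp: zs nth_append)
    moreover have "set zs \<union> set ys = {1..n}"
    proof -
      have "Suc n \<notin> set zs" "Suc n \<notin> set ys"
        using sorted disj zs by (auto simp: sorted_wrt_append)
      then have "set zs \<union> set ys = (set xs \<union> set ys) - {Suc n}" using zs by auto
      then show ?thesis using un by (simp add: atLeastAtMostSuc_conv)
    qed
    ultimately have "(zs, ys) \<in> ?A"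
      using sorted len disj zs by (simp add: column_pairs_def sorted_wrt_append)
    then show ?thesis using p zs by force
  next
    assume "Suc n \<in> set ys"
    then obtain zs where zs: "ys = zs @ [Suc n]"
      using strict_sorted_snoc_Max[OF sorted(2)] bound by blast
    have "\<forall>k<length zs. xs ! k < zs ! k"
    proof (intro allI impI)
      fix k assume k: "k < length zs"
      then show "xs ! k < zs ! k" using less[rule_format, of k] by (simp add: zs nth_append)
    qed
    moreover have "set xs \<union> set zs = {1..n}"
    proof -
      have "Suc n \<notin> set zs" "Suc n \<notin> set xs"
        using sorted disj zs by (auto simp: sorted_wrt_append)
      then have "set xs \<union> set zs = (set xs \<union> set ys) - {Suc n}" using zs by auto
      then show ?thesis using un by (simp add: atLeastAtMostSuc_conv)
    qed
    ultimately have "(xs, zs) \<in> ?B"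
      using sorted len disj zs by (auto simp: column_pairs_def sorted_wrt_append)
    then show ?thesis using p zs by force
  qed
next
  fix p assume "p \<in> ?f ` ?A \<union> ?h ` ?B"
  then consider (1) xs ys where "(xs, ys) \<in> column_pairs n b" "p = (xs @ [Suc n], ys)"
    | (2) xs ys where "0 < b" "(xs, ys) \<in> column_pairs n (b - 1)" "length ys < length xs"
      "p = (xs, ys @ [Suc n])"
    by auto
  then show "p \<in> ?L"
  proof cases
    case 1
    then have un: "set xs \<union> set ys = {1..n}" by (simp add: column_pairs_def)
    then have "set xs \<subseteq> {1..n}" by blast
    then have "\<forall>x\<in>set xs. x < Suc n" by auto
    then show ?thesis
      using 1 un by (auto simp: column_pairs_def sorted_wrt_append nth_append atLeastAtMostSuc_conv)
  next
    case 2
    then have un: "set xs \<union> set ys = {1..n}" by (simp add: column_pairs_def)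
    then have less: "x < Suc n" if "x \<in> set xs \<union> set ys" for x using that by simp
    \<comment> \<open>This is the left neighbour of the new box; it exists because the second column
      is strictly shorter.\<close>
    have "xs ! length ys < Suc n" using 2 less by simp
    then have "\<forall>k<length (ys @ [Suc n]). xs ! k < (ys @ [Suc n]) ! k"
    proof (intro allI impI)
      fix k assume "k < length (ys @ [Suc n])"
      then consider "k < length ys" | "k = length ys" by force
      then show "xs ! k < (ys @ [Suc n]) ! k"
        using 2 \<open>xs ! length ys < Suc n\<close> by cases (auto simp: column_pairs_def nth_append)
    qed
    moreover have "set xs \<union> set (ys @ [Suc n]) = {1..Suc n}"
      using un by (auto simp: atLeastAtMostSuc_conv)
    moreover have "Suc n \<notin> set xs" "\<forall>y\<in>set ys. y < Suc n"
      using less by blast+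
    ultimately show ?thesis
      using 2 by (auto simp: column_pairs_def sorted_wrt_append)
  qed
qed

text \<open>The new box has position \<open>length xs = n - b\<close>, which yields the factor
  \<open>Suc n - (n - b)\<close>. The factors of the second column are unchanged because
  \<open>Suc n\<close> exceeds all its entries.\<close>

lemma column_weight_snoc_left:
  assumes "(xs, ys) \<in> column_pairs n b"
  shows "column_weight (xs @ [Suc n], ys) = Suc b * column_weight (xs, ys)"
proof -
  have "Suc n - length xs = Suc b" using length_column_pairs[OF assms] by simp
  moreover have "{j. k \<le> j \<and> j < Suc (length xs) \<and> (xs @ [Suc n]) ! j \<le> ys ! k} =
      {j. k \<le> j \<and> j < length xs \<and> xs ! j \<le> ys ! k}" if "k < length ys" for k
  proof -
    have "ys ! k \<in> set ys" using that by simp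
    then have "ys ! k \<le> n" using assms by (auto simp: column_pairs_def)
    then show ?thesis by (auto simp: nth_append less_Suc_eq)
  qed
  ultimately show ?thesis
    by (simp add: column_weight_def nth_append lessThan_Suc algebra_simps)
qed

text \<open>The entry \<open>Suc n\<close> exceeds the whole first column, so its factor counts the
  positions from \<open>b\<close> up to \<open>n - b - 1\<close>. For columns of equal height both
  sides vanish.\<close>

lemma column_weight_snoc_right:
  assumes "(xs, ys) \<in> column_pairs n b"
  shows "column_weight (xs, ys @ [Suc n]) = (n - 2 * b) * column_weight (xs, ys)"
proof -
  have len: "length xs + b = n" "length ys = b"
    using length_column_pairs[OF assms] assms by (auto simp: column_pairs_def)
  have "xs ! j \<le> Suc n" if "j < length xs" for j
  proof -
    have "xs ! j \<in> set xs" using that by simp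
    then have "xs ! j \<in> {1..n}" using assms by (auto simp: column_pairs_def)
    then show ?thesis by simp
  qed
  then have "{j. b \<le> j \<and> j < length xs \<and> xs ! j \<le> Suc n} = {b..<length xs}" by auto
  then have "card {j. b \<le> j \<and> j < length xs \<and> xs ! j \<le> Suc n} = n - 2 * b"
    using len by simp
  then show ?thesis
    using len by (simp add: column_weight_def nth_append lessThan_Suc)
qed

lemma sum_column_weight_Suc:
  "(\<Sum>p\<in>column_pairs (Suc n) b. column_weight p) =
     Suc b * (\<Sum>p\<in>column_pairs n b. column_weight p) +
     (if b = 0 then 0 else (n - 2 * (b - 1)) * (\<Sum>p\<in>column_pairs n (b - 1). column_weight p))"
proof -
  let ?f = "\<lambda>(xs, ys). (xs @ [Suc n], ys :: nat list)"
  let ?h = "\<lambda>(xs :: nat list, ys). (xs, ys @ [Suc n])"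
  let ?A = "column_pairs n b"
  let ?B = "{(xs, ys). 0 < b \<and> (xs, ys) \<in> column_pairs n (b - 1) \<and> length ys < length xs}"
  have finB: "finite ?B"
    by (rule finite_subset[OF _ finite_column_pairs[of n "b - 1"]]) auto
  have disj: "?f ` ?A \<inter> ?h ` ?B = {}"
  proof -
    have "Suc n \<notin> set ys" if "(xs, ys) \<in> ?A" for xs ys
      using that by (auto simp: column_pairs_def)
    then show ?thesis by fastforce
  qed
  have "(\<Sum>p\<in>?f ` ?A. column_weight p) = (\<Sum>p\<in>?A. column_weight (?f p))"
    by (subst sum.reindex) (auto simp: inj_on_def)
  also have "\<dots> = (\<Sum>p\<in>?A. Suc b * column_weight p)"
    by (rule sum.cong) (auto simp: column_weight_snoc_left simp del: mult_Suc)
  finally have A: "(\<Sum>p\<in>?f ` ?A. column_weight p) = Suc b * (\<Sum>p\<in>?A. column_weight p)"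
    by (simp only: sum_distrib_left)
  have B: "(\<Sum>p\<in>?h ` ?B. column_weight p) =
    (n - 2 * (b - 1)) * (\<Sum>p\<in>column_pairs n (b - 1). column_weight p)" if b: "b \<noteq> 0"
  proof -
    have "(\<Sum>p\<in>?h ` ?B. column_weight p) = (\<Sum>p\<in>?B. column_weight (?h p))"
      by (subst sum.reindex) (auto simp: inj_on_def)
    also have "\<dots> = (\<Sum>p\<in>?B. (n - 2 * (b - 1)) * column_weight p)"
      by (rule sum.cong) (auto simp: column_weight_snoc_right)
    \<comment> \<open>The pairs added to the range of summation have columns of equal height, so
      their factor \<open>n - 2 * (b - 1)\<close> is zero.\<close>
    also have "\<dots> = (\<Sum>p\<in>column_pairs n (b - 1). (n - 2 * (b - 1)) * column_weight p)"
    proof (rule sum.mono_neutral_left)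
      show "\<forall>p\<in>column_pairs n (b - 1) - ?B. (n - 2 * (b - 1)) * column_weight p = 0"
      proof
        fix p assume p: "p \<in> column_pairs n (b - 1) - ?B"
        then obtain xs ys where xy: "p = (xs, ys)" "(xs, ys) \<in> column_pairs n (b - 1)"
          "length xs \<le> length ys"
          using b by (cases p) auto
        then have "n - 2 * (b - 1) = 0"
          using length_column_pairs[OF xy(2)] by (simp add: column_pairs_def)
        then show "(n - 2 * (b - 1)) * column_weight p = 0" by simp
      qed
    qed (auto simp: finite_column_pairs)
    finally show ?thesis by (simp only: sum_distrib_left)
  qed
  have "(\<Sum>p\<in>column_pairs (Suc n) b. column_weight p) =
      (\<Sum>p\<in>?f ` ?A. column_weight p) + (\<Sum>p\<in>?h ` ?B. column_weight p)"
    unfolding column_pairs_Suc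
    by (rule sum.union_disjoint) (use finB finite_column_pairs disj in auto)
  then show ?thesis using A B by auto
qed

text \<open>Both sides obey the same recurrence, a tree with \<open>b + 1\<close> leaves
  corresponding to a second column of height \<open>b\<close>. The shift turns
  \<open>n + 2 - 2 * b\<close> into \<open>n - 2 * (b - 1)\<close>, and for \<open>b = 0\<close> the
  extra tree term is \<open>S n 0 = 0\<close>.\<close>

lemma S_eq_sum_column_weight: "S n (Suc b) = (\<Sum>p\<in>column_pairs n b. column_weight p)"
proof (induction n arbitrary: b)
  case 0
  have "column_pairs 0 b = (if b = 0 then {([], [])} else {})"
    by (auto simp: column_pairs_def)
  then show ?case by (simp add: S_0_left column_weight_def)
next
  case (Suc n)
  show ?case
  proof (cases b)
    case 0
    then show ?thesis by (simp add: S_Suc S_0_right sum_column_weight_Suc Suc.IH)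
  next
    case (Suc c)
    then show ?thesis
      by (simp add: S_Suc sum_column_weight_Suc flip: Suc.IH)
  qed
qed

section \<open>The correspondence between pairs of columns and tableaux\<close>

lemma boxes_of_columns:
  assumes "length ys \<le> length xs"
  shows "boxes (of_columns (xs, ys)) =
    (\<lambda>k. (Suc k, 1)) ` {..<length xs} \<union> (\<lambda>k. (Suc k, 2)) ` {..<length ys}"
proof -
  have "(r, c) \<in> boxes (of_columns (xs, ys)) \<longleftrightarrow>
    (r, c) \<in> (\<lambda>k. (Suc k, 1)) ` {..<length xs} \<union> (\<lambda>k. (Suc k, 2)) ` {..<length ys}" for r c
    using assms
    by (cases r) (auto simp: boxes_def of_columns_def image_iff split: if_splits)
  then show ?thesis by auto
qed

lemma entry_of_columns:
  assumes "length ys \<le> length xs"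
  shows "k < length xs \<Longrightarrow> entry (of_columns (xs, ys)) (Suc k, 1) = xs ! k"
    and "k < length ys \<Longrightarrow> entry (of_columns (xs, ys)) (Suc k, 2) = ys ! k"
  using assms by (auto simp: entry_def of_columns_def)

lemma shape_of_columns:
  assumes "length ys \<le> length xs"
  shows "shape (of_columns (xs, ys)) = replicate (length ys) 2 @ replicate (length xs - length ys) 1"
  using assms by (intro nth_equalityI) (auto simp: shape_def of_columns_def nth_append)

text \<open>Strictly increasing columns have no repetition, so injectivity can fail only through an
  entry common to both columns.\<close>

lemma bij_betw_entry_of_columns:
  assumes "length ys \<le> length xs" "sorted_wrt (<) xs" "sorted_wrt (<) ys"
  shows "bij_betw (entry (of_columns (xs, ys))) (boxes (of_columns (xs, ys))) {1..n} \<longleftrightarrow>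
    set xs \<union> set ys = {1..n} \<and> set xs \<inter> set ys = {}"
proof -
  let ?e = "entry (of_columns (xs, ys))"
  let ?X = "(\<lambda>k. (Suc k, 1::nat)) ` {..<length xs}"
  let ?Y = "(\<lambda>k. (Suc k, 2::nat)) ` {..<length ys}"
  have X: "?e ` ?X = set xs" and Y: "?e ` ?Y = set ys"
    using entry_of_columns[OF assms(1)]
    by (auto simp: image_image set_conv_nth)
  have dist: "distinct xs" "distinct ys" using assms by (auto simp: strict_sorted_iff)
  then have inj: "inj_on ?e ?X" "inj_on ?e ?Y"
    using entry_of_columns[OF assms(1)] by (auto simp: inj_on_def nth_eq_iff_index_eq)
  have "?X - ?Y = ?X" "?Y - ?X = ?Y" by auto
  then have "inj_on ?e (?X \<union> ?Y) \<longleftrightarrow> set xs \<inter> set ys = {}"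
    using inj by (simp only: inj_on_Un X Y) simp
  then show ?thesis
    unfolding bij_betw_def boxes_of_columns[OF assms(1)] image_Un X Y by blast
qed

text \<open>The row condition becomes \<open>xs ! k < ys ! k\<close>, the column condition becomes
  strict sortedness, and the shape is a partition since the second column is no taller than the
  first.\<close>

lemma of_columns_in_SYT_iff:
  assumes "length ys \<le> length xs"
  shows "of_columns (xs, ys) \<in> SYT n \<longleftrightarrow> (xs, ys) \<in> column_pairs n (length ys)"
proof -
  let ?T = "of_columns (xs, ys)"
  note e = entry_of_columns[OF assms]
  have replicate: "sorted_wrt (\<ge>) (replicate m x)" for m x :: nat
    by (induction m) auto
  have shape: "sorted_wrt (\<ge>) (shape ?T)" "\<forall>k\<in>set (shape ?T). 0 < k"
    using assms by (auto simp: shape_of_columns sorted_wrt_append replicate)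
  have row: "(\<forall>r c. (r, c) \<in> boxes ?T \<and> (r, Suc c) \<in> boxes ?T \<longrightarrow>
      entry ?T (r, c) < entry ?T (r, Suc c)) \<longleftrightarrow> (\<forall>k<length ys. xs ! k < ys ! k)" (is "?L \<longleftrightarrow> ?R")
  proof
    assume ?L
    show ?R
    proof (intro allI impI)
      fix k assume k: "k < length ys"
      then have "entry ?T (Suc k, 1) < entry ?T (Suc k, Suc 1)"
        using \<open>?L\<close>[rule_format, of "Suc k" 1] assms by (simp add: boxes_of_columns image_iff)
      then show "xs ! k < ys ! k" using e(1)[of k] e(2)[of k] k assms by (simp add: numeral_2_eq_2)
    qed
  next
    assume R: ?R
    show ?L
    proof (intro allI impI)
      fix r c assume "(r, c) \<in> boxes ?T \<and> (r, Suc c) \<in> boxes ?T"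
      then obtain k where k: "r = Suc k" "c = 1" "k < length ys"
        using assms by (auto simp: boxes_of_columns)
      then show "entry ?T (r, c) < entry ?T (r, Suc c)"
        using e(1)[of k] e(2)[of k] R assms by (simp add: numeral_2_eq_2)
    qed
  qed
  have col: "(\<forall>r c. (r, c) \<in> boxes ?T \<and> (Suc r, c) \<in> boxes ?T \<longrightarrow>
      entry ?T (r, c) < entry ?T (Suc r, c)) \<longleftrightarrow> sorted_wrt (<) xs \<and> sorted_wrt (<) ys"
    (is "?L \<longleftrightarrow> ?R")
  proof
    assume L: ?L
    have "xs ! k < xs ! Suc k" if "Suc k < length xs" for k
      using L[rule_format, of "Suc k" 1] e(1)[of k] e(1)[of "Suc k"] that assms
      by (simp add: boxes_of_columns image_iff)
    moreover have "ys ! k < ys ! Suc k" if "Suc k < length ys" for k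
      using L[rule_format, of "Suc k" 2] e(2)[of k] e(2)[of "Suc k"] that assms
      by (simp add: boxes_of_columns image_iff)
    ultimately show ?R by (simp add: sorted_wrt_iff_nth_Suc_transp)
  next
    assume R: ?R
    show ?L
    proof (intro allI impI)
      fix r c assume "(r, c) \<in> boxes ?T \<and> (Suc r, c) \<in> boxes ?T"
      then consider k where "r = Suc k" "c = 1" "Suc k < length xs"
        | k where "r = Suc k" "c = 2" "Suc k < length ys"
        using assms by (auto simp: boxes_of_columns)
      then show "entry ?T (r, c) < entry ?T (Suc r, c)"
      proof cases
        case 1
        then show ?thesis using R e(1)[of k] e(1)[of "Suc k"] by (simp add: sorted_wrt_iff_nth_less)
      next
        case 2
        then show ?thesis using R e(2)[of k] e(2)[of "Suc k"] by (simp add: sorted_wrt_iff_nth_less)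
      qed
    qed
  qed
  have size: "tsize ?T = n" if "(xs, ys) \<in> column_pairs n (length ys)"
    using length_column_pairs[OF that] assms
    by (simp add: tsize_def shape_of_columns sum_list_replicate)
  show ?thesis
    using shape size assms bij_betw_entry_of_columns[OF assms, of n]
    unfolding SYT_def mem_Collect_eq row col by (auto simp: column_pairs_def)
qed

text \<open>Row lengths are 1 or 2 and weakly decrease upwards, so the rows of length 2 form an
  initial segment; their number \<open>b\<close> is the height of the second column.\<close>

lemma two_column_tableauE:
  assumes "T \<in> SYT n" "\<forall>k\<in>set (shape T). k \<le> 2"
  obtains xs ys where "length ys \<le> length xs" "T = of_columns (xs, ys)"
proof -
  let ?B = "{k. k < length T \<and> length (T ! k) = 2}"
  define b where "b = card ?B"
  have len: "length (T ! k) = 1 \<or> length (T ! k) = 2" if "k < length T" for k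
  proof -
    have "length (T ! k) \<in> set (shape T)" using that by (simp add: shape_def)
    then have "0 < length (T ! k)" "length (T ! k) \<le> 2" using assms by (auto simp: SYT_def)
    then show ?thesis by linarith
  qed
  have "sorted_wrt (\<ge>) (shape T)" using assms by (simp add: SYT_def)
  then have anti: "length (T ! j) \<le> length (T ! i)" if "i < j" "j < length T" for i j
    using that by (auto simp: shape_def sorted_wrt_iff_nth_less)
  have down: "i \<in> ?B" if "j \<in> ?B" "i < j" for i j
    using anti[of i j] len[of i] that by auto
  have B: "?B = {..<b}"
  proof -
    \<comment> \<open>The least index outside \<open>?B\<close>, which may be
      \<open>length T\<close>; downward closure then gives \<open>?B = {..<m}\<close>, and comparing
      cardinalities gives \<open>m = b\<close>.\<close>
    define m where "m = (LEAST m. m \<notin> ?B)"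
    have "length T \<notin> ?B" by simp
    then have "m \<notin> ?B" unfolding m_def by (rule LeastI)
    moreover have "k \<in> ?B" if "k < m" for k
      using not_less_Least[of k "\<lambda>m. m \<notin> ?B"] that unfolding m_def by blast
    ultimately have "?B = {..<m}"
      using down by (metis (no_types, lifting) lessThan_iff linorder_neqE_nat subsetI subset_antisym)
    then show ?thesis unfolding b_def by (metis card_lessThan)
  qed
  have "b \<le> length T" unfolding b_def using card_mono[of "{..<length T}" ?B] by auto
  let ?xs = "map (\<lambda>k. T ! k ! 0) [0..<length T]"
  let ?ys = "map (\<lambda>k. T ! k ! 1) [0..<b]"
  have "T = of_columns (?xs, ?ys)"
  proof (rule nth_equalityI)
    fix k assume k: "k < length T"
    have "length (T ! k) = (if k < b then 2 else 1)"
      using B k len[of k] by auto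
    then show "T ! k = of_columns (?xs, ?ys) ! k"
      using k by (intro nth_equalityI) (auto simp: of_columns_def less_2_cases_iff)
  qed (simp add: of_columns_def)
  then show thesis using that[of ?ys ?xs] \<open>b \<le> length T\<close> by simp
qed

lemma two_column_SYT:
  "{T\<in>SYT n. \<forall>k\<in>set (shape T). k \<le> 2} = of_columns ` (\<Union>b\<le>n div 2. column_pairs n b)"
proof (intro equalityI subsetI)
  fix T assume "T \<in> {T\<in>SYT n. \<forall>k\<in>set (shape T). k \<le> 2}"
  then have T: "T \<in> SYT n" "\<forall>k\<in>set (shape T). k \<le> 2" by auto
  then obtain xs ys where xy: "length ys \<le> length xs" "T = of_columns (xs, ys)"
    by (rule two_column_tableauE)
  then have "(xs, ys) \<in> column_pairs n (length ys)" using T of_columns_in_SYT_iff by blast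
  moreover from this have "length ys \<le> n div 2" using length_column_pairs xy(1) by fastforce
  ultimately show "T \<in> of_columns ` (\<Union>b\<le>n div 2. column_pairs n b)" using xy by blast
next
  fix T assume "T \<in> of_columns ` (\<Union>b\<le>n div 2. column_pairs n b)"
  then obtain xs ys b where xy: "T = of_columns (xs, ys)" "(xs, ys) \<in> column_pairs n b" by auto
  then have len: "length ys \<le> length xs" "b = length ys" by (auto simp: column_pairs_def)
  then show "T \<in> {T\<in>SYT n. \<forall>k\<in>set (shape T). k \<le> 2}"
    using xy by (auto simp: of_columns_in_SYT_iff shape_of_columns)
qed

text \<open>The set of boxes determines both column heights, and the entries then determine the
  columns.\<close>

lemma inj_on_of_columns: "inj_on of_columns {(xs, ys). length ys \<le> length xs}"
proof (rule inj_onI, clarsimp)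
  fix xs ys xs' ys' :: "nat list"
  assume len: "length ys \<le> length xs" "length ys' \<le> length xs'"
    and eq: "of_columns (xs, ys) = of_columns (xs', ys')"
  note B = boxes_of_columns[OF len(1)] boxes_of_columns[OF len(2)]
  have "k < length xs \<longleftrightarrow> (Suc k, 1) \<in> boxes (of_columns (xs, ys))"
    "k < length xs' \<longleftrightarrow> (Suc k, 1) \<in> boxes (of_columns (xs', ys'))"
    "k < length ys \<longleftrightarrow> (Suc k, 2) \<in> boxes (of_columns (xs, ys))"
    "k < length ys' \<longleftrightarrow> (Suc k, 2) \<in> boxes (of_columns (xs', ys'))" for k
    unfolding B by (auto simp: image_iff)
  then have "length xs = length xs'" "length ys = length ys'"
    using eq by (metis linorder_neqE_nat less_irrefl)+
  then show "xs = xs' \<and> ys = ys'"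
    using eq entry_of_columns[OF len(1)] entry_of_columns[OF len(2)]
    by (auto intro!: nth_equalityI)
qed

text \<open>As \<open>entry\<close> is a bijection from boxes to values, the product over values
  becomes a product over boxes, which splits into the two columns.\<close>

lemma g_index_of_columns:
  assumes "(xs, ys) \<in> column_pairs n b"
  shows "g_index (of_columns (xs, ys)) = column_weight (xs, ys)"
proof -
  let ?T = "of_columns (xs, ys)"
  let ?X = "(\<lambda>k. (Suc k, 1::nat)) ` {..<length xs}"
  let ?Y = "(\<lambda>k. (Suc k, 2::nat)) ` {..<length ys}"
  have len: "length ys \<le> length xs" and b: "length ys = b" and un: "set xs \<union> set ys = {1..n}"
    using assms by (auto simp: column_pairs_def)
  note e = entry_of_columns[OF len]
  have T: "?T \<in> SYT n" using of_columns_in_SYT_iff[OF len] assms b by simp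
  then have bij: "bij_betw (entry ?T) (boxes ?T) {1..n}" and size: "tsize ?T = n"
    by (auto simp: SYT_def)
  have pos: "position ?T (entry ?T p) = p" if "p \<in> boxes ?T" for p
    unfolding position_def
    using that bij by (intro the_equality) (auto simp: bij_betw_def inj_on_def)
  have box: "boxes ?T = ?X \<union> ?Y" by (rule boxes_of_columns[OF len])
  have gX: "g ?T (entry ?T (Suc k, 1)) = xs ! k - k" if k: "k < length xs" for k
  proof -
    have "(Suc k, 1) \<in> boxes ?T" using k box by auto
    note p = pos[OF this]
    have "xs ! k \<in> set xs" using k by simp
    \<comment> \<open>Column 0 has only \<open>n\<close> boxes; this bound ensures that it reaches
      row \<open>xs ! k\<close>.\<close>
    then have "xs ! k \<le> n" using un by auto
    then have "{j'. Suc k \<le> j' \<and> (j', 0) \<in> ext_boxes ?T \<and> ext_entry ?T (j', 0) \<le> xs ! k} =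
        {Suc k..xs ! k}"
      by (auto simp: ext_boxes_def ext_entry_def size boxes_def)
    then show ?thesis using p e(1)[OF k] by (simp add: g_def)
  qed
  have gY: "g ?T (entry ?T (Suc k, 2)) = card {j. k \<le> j \<and> j < length xs \<and> xs ! j \<le> ys ! k}"
    if k: "k < length ys" for k
  proof -
    have "(Suc k, 2) \<in> boxes ?T" using k box by auto
    note p = pos[OF this]
    have "{j'. Suc k \<le> j' \<and> (j', 1) \<in> ext_boxes ?T \<and> ext_entry ?T (j', 1) \<le> ys ! k} =
        Suc ` {j. k \<le> j \<and> j < length xs \<and> xs ! j \<le> ys ! k}" (is "?L = ?R")
    proof (intro equalityI subsetI)
      fix j' assume "j' \<in> ?L"
      then obtain j where "j' = Suc j" "k \<le> j" "j < length xs" "entry ?T (Suc j, 1) \<le> ys ! k"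
        by (auto simp: ext_boxes_def ext_entry_def box)
      then show "j' \<in> ?R" using e(1)[of j] by auto
    next
      fix j' assume "j' \<in> ?R"
      then obtain j where "j' = Suc j" "k \<le> j" "j < length xs" "xs ! j \<le> ys ! k" by auto
      then show "j' \<in> ?L" using e(1)[of j] by (auto simp: ext_boxes_def ext_entry_def box)
    qed
    then show ?thesis using p e(2)[OF k] by (simp add: g_def card_image)
  qed
  have "g_index ?T = (\<Prod>p\<in>boxes ?T. g ?T (entry ?T p))"
    unfolding g_index_def size using prod.reindex_bij_betw[OF bij] by metis
  also have "\<dots> = (\<Prod>p\<in>?X. g ?T (entry ?T p)) * (\<Prod>p\<in>?Y. g ?T (entry ?T p))"
    unfolding box by (rule prod.union_disjoint) auto
  also have "(\<Prod>p\<in>?X. g ?T (entry ?T p)) = (\<Prod>k<length xs. xs ! k - k)"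
    by (subst prod.reindex) (use gX in \<open>auto simp: inj_on_def\<close>)
  also have "(\<Prod>p\<in>?Y. g ?T (entry ?T p)) =
      (\<Prod>k<length ys. card {j. k \<le> j \<and> j < length xs \<and> xs ! j \<le> ys ! k})"
    by (subst prod.reindex) (use gY in \<open>auto simp: inj_on_def\<close>)
  finally show ?thesis by (simp add: column_weight_def)
qed

text \<open>Every row of length 2 contributes \<open>2!\<close> and every other row contributes 1.
  This is the source of the powers of two on the tree side.\<close>

lemma shape_fact_of_columns:
  assumes "length ys \<le> length xs"
  shows "shape_fact (of_columns (xs, ys)) = 2 ^ length ys"
  using assms by (simp add: shape_fact_def shape_of_columns prod_list_replicate)

section \<open>Comparison of the two polynomials\<close>

lemma sum_monom: "(\<Sum>x\<in>A. monom (f x) k) = monom (\<Sum>x\<in>A. f x) k"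
  by (induction A rule: infinite_finite_induct) (simp_all add: add_monom)

theorem theorem22:
  fixes n :: nat
  assumes "n \<ge> 1"
  shows "(\<Sum>i=1..(n + 2) div 2. monom (2 ^ (i - 1) * int (S n i)) i) =
         (\<Sum>T\<in>{T\<in>SYT n. \<forall>k\<in>set (shape T). k \<le> 2}.
            monom (int (g_index T * shape_fact T)) (n + 1 - length (shape T)))"
proof -
  let ?w = "\<lambda>T. monom (int (g_index T * shape_fact T)) (n + 1 - length (shape T))"
  have "inj_on of_columns (\<Union>b\<le>n div 2. column_pairs n b)"
    by (rule inj_on_subset[OF inj_on_of_columns]) (auto simp: column_pairs_def)
  then have "(\<Sum>T\<in>{T\<in>SYT n. \<forall>k\<in>set (shape T). k \<le> 2}. ?w T) =
      (\<Sum>p\<in>(\<Union>b\<le>n div 2. column_pairs n b). ?w (of_columns p))"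
    unfolding two_column_SYT by (simp add: sum.reindex)
  also have "\<dots> = (\<Sum>b\<le>n div 2. \<Sum>p\<in>column_pairs n b. ?w (of_columns p))"
    \<comment> \<open>The sets for different \<open>b\<close> are disjoint because \<open>b\<close>
      is the length of the second column.\<close>
    by (rule sum.UNION_disjoint) (auto simp: finite_column_pairs, auto simp: column_pairs_def)
  also have "\<dots> = (\<Sum>b\<le>n div 2. monom (2 ^ b * int (S n (Suc b))) (Suc b))"
  proof (rule sum.cong)
    fix b
    have "(\<Sum>p\<in>column_pairs n b. ?w (of_columns p)) =
        (\<Sum>p\<in>column_pairs n b. monom (2 ^ b * int (column_weight p)) (Suc b))"
    proof (rule sum.cong)
      fix p assume p: "p \<in> column_pairs n b"
      obtain xs ys where xy: "p = (xs, ys)" by force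
      have len: "length ys \<le> length xs" "length ys = b" "length xs + b = n"
        using p xy length_column_pairs by (auto simp: column_pairs_def)
      \<comment> \<open>The tableau has \<open>length xs = n - b\<close> rows, so the exponent
        equals the number \<open>b + 1\<close> of leaves.\<close>
      then have "n + 1 - length (shape (of_columns p)) = Suc b"
        by (simp add: xy shape_of_columns)
      then show "?w (of_columns p) = monom (2 ^ b * int (column_weight p)) (Suc b)"
        using p len unfolding xy by (simp add: g_index_of_columns shape_fact_of_columns mult.commute)
    qed simp
    then show "(\<Sum>p\<in>column_pairs n b. ?w (of_columns p)) =
        monom (2 ^ b * int (S n (Suc b))) (Suc b)"
      by (simp add: sum_monom S_eq_sum_column_weight flip: sum_distrib_left)
  qed simp
  also have "\<dots> = (\<Sum>i=1..(n + 2) div 2. monom (2 ^ (i - 1) * int (S n i)) i)"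
    \<comment> \<open>The substitution \<open>i = b + 1\<close> matches the ranges, as
      \<open>(n + 2) div 2 = n div 2 + 1\<close>.\<close>
    by (rule sum.reindex_bij_witness[of _ "\<lambda>i. i - 1" Suc]) auto
  finally show ?thesis by simp
qed

end
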